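(* Let $r\ge 1$ be an integer and let $f(t)=\sum_{n=0}^{\infty} d_n\frac{t^n}{n!}\in\mathbb{C}[[t]]$ be a formal power series with $d_0=1$. Let the numbers $a_n^{(r)}\in\mathbb{C}$ $(n\ge 0)$ be defined by $$\frac{1}{(f(t))^r}=\sum_{n=0}^{\infty}a_n^{(r)}\frac{t^n}{n!}.$$ For every integer $e\ge 1$ put $$D_r(e)=\sum_{\substack{i_1+\cdots+i_r=e\\ i_1,\dots,i_r\ge 0}}\frac{d_{i_1}\cdots d_{i_r}}{i_1!\cdots i_r!}.$$ Then for every integer $n\ge 1$, $$a_n^{(r)}=(-1)^n\, n!\,\det\left(m_{i,j}\right)_{1\le i,j\le n},$$ where $m_{i,j}=D_r(i-j+1)$ if $j\le i$, $m_{i,i+1}=1$ for $1\le i\le n-1$, and $m_{i,j}=0$ if $j>i+1$; that is, $$a_n^{(r)}=(-1)^n n!\left|\begin{array}{ccccc} D_r(1)&1&0&\cdots&0\\ D_r(2)&D_r(1)&1&\ddots&\vdots\\ \vdots&\vdots&\ddots&\ddots&0\\ D_r(n-1)&D_r(n-2)&\cdots&D_r(1)&1\\ D_r(n)&D_r(n-1)&\cdots&D_r(2)&D_r(1)\end{array}\right|.$$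
   Context: The numbers $a_n^{(r)}$ are called the related numbers of higher order Appell polynomials: the higher order Appell polynomials $A_n^{(r)}(z)$ are defined by $\frac{e^{zt}}{(f(t))^r}=\sum_{n=0}^{\infty}A_n^{(r)}(z)\frac{t^n}{n!}$, and $a_n^{(r)}=A_n^{(r)}(0)$. In the sum defining $D_r(e)$, $(i_1,\dots,i_r)$ ranges over ordered $r$-tuples of integers. *)

theory Defs
  imports
    "HOL-Computational_Algebra.Formal_Power_Series"
    "Jordan_Normal_Form.Determinant"
begin

definition exp_gen_fun :: "(nat \<Rightarrow> complex) \<Rightarrow> complex fps" where
  "exp_gen_fun c = Abs_fps (\<lambda>n. c n / fact n)"

(* Ordered r-tuples of natural numbers are lists of length r; the index set is finite. *)
definition D :: "(nat \<Rightarrow> complex) \<Rightarrow> nat \<Rightarrow> nat \<Rightarrow> complex" where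
  "D d r e = (\<Sum>is \<in> {is :: nat list. length is = r \<and> sum_list is = e}.
                (\<Prod>k<r. d (is ! k)) / (\<Prod>k<r. fact (is ! k)))"

(* Matrix indices start at 0, so the entry (i, j) here is m_{i+1,j+1}. The index
   differences, and hence the case distinctions, are not affected by the shift. *)
definition D_matrix :: "(nat \<Rightarrow> complex) \<Rightarrow> nat \<Rightarrow> nat \<Rightarrow> complex mat" where
  "D_matrix d r n = mat n n (\<lambda>(i, j).
     if j \<le> i then D d r (i - j + 1) else if j = i + 1 then 1 else 0)"

end

theory Submission
  imports Defs
begin

text \<open>
  The proof is Cramer's rule. Writing \<open>g = f ^ r\<close> and \<open>b\<close> for the coefficient sequence of \<open>1 / g\<close>,
  the identity \<open>g * (1 / g) = 1\<close> read coefficient by coefficient up to degree \<open>n\<close> is a linear system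
  \<open>L b = e\<close>, where \<open>L\<close> is the lower triangular Toeplitz matrix of the coefficients of \<open>g\<close> and \<open>e\<close> is
  the first unit vector. As \<open>g\<close> has constant term \<open>1\<close>, \<open>L\<close> has determinant \<open>1\<close>, so \<open>b n\<close> is the
  determinant of \<open>L\<close> with its last column replaced by \<open>e\<close>. Expanding along that column leaves
  \<open>(-1) ^ n\<close> times the minor of \<open>L\<close> without its first row and last column. Removing the first row
  moves the diagonal of \<open>L\<close>, which consists of ones, to the superdiagonal: this is the Hessenberg
  matrix of the theorem (\<open>fps_nth_inverse_eq_det\<close>). Finally \<open>D d r e\<close> is the coefficient of
  \<open>t ^ e\<close> in \<open>f ^ r\<close>, by multiplying out the power (\<open>D_eq_fps_nth_power\<close>).
\<close>

definition lower_toeplitz_mat :: "'a :: zero fps \<Rightarrow> nat \<Rightarrow> 'a mat" where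
  "lower_toeplitz_mat g m = mat m m (\<lambda>(i, j). if j \<le> i then fps_nth g (i - j) else 0)"

lemma lower_toeplitz_mat_carrier [simp]: "lower_toeplitz_mat g m \<in> carrier_mat m m"
  by (simp add: lower_toeplitz_mat_def)

lemma det_lower_toeplitz_mat:
  fixes g :: "'a :: comm_ring_1 fps"
  shows "det (lower_toeplitz_mat g m) = fps_nth g 0 ^ m"
proof -
  have "det (lower_toeplitz_mat g m) = prod_list (diag_mat (lower_toeplitz_mat g m))"
    by (rule det_lower_triangular[where n = m]) (auto simp: lower_toeplitz_mat_def)
  also have "diag_mat (lower_toeplitz_mat g m) = replicate m (fps_nth g 0)"
    by (rule nth_equalityI) (auto simp: diag_mat_def lower_toeplitz_mat_def)
  finally show ?thesis by simp
qed

text \<open>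
  Coefficient \<open>i\<close> of a product involves only coefficients up to \<open>i\<close> of the factors, so truncating
  the system at size \<open>m\<close> loses nothing.
\<close>

lemma lower_toeplitz_mat_mult_vec:
  fixes g h :: "'a :: comm_ring_1 fps"
  shows "lower_toeplitz_mat g m *\<^sub>v vec m (fps_nth h) = vec m (fps_nth (h * g))"
proof (rule eq_vecI)
  fix i assume "i < dim_vec (vec m (fps_nth (h * g)))"
  then have i: "i < m" by simp
  have "(lower_toeplitz_mat g m *\<^sub>v vec m (fps_nth h)) $ i =
          (\<Sum>j\<in>{0..<m}. if j \<le> i then fps_nth h j * fps_nth g (i - j) else 0)"
    using i by (auto simp: lower_toeplitz_mat_def scalar_prod_def mult.commute intro!: sum.cong)
  also have "\<dots> = (\<Sum>j\<in>{0..i}. fps_nth h j * fps_nth g (i - j))"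
    using i by (intro sum.mono_neutral_cong_right) auto
  also have "\<dots> = vec m (fps_nth (h * g)) $ i"
    using i by (simp add: fps_mult_nth)
  finally show "(lower_toeplitz_mat g m *\<^sub>v vec m (fps_nth h)) $ i = vec m (fps_nth (h * g)) $ i" .
qed (simp add: lower_toeplitz_mat_def)

lemma fps_nth_inverse_eq_det:
  fixes g h :: "'a :: comm_ring_1 fps"
  assumes inv: "h * g = 1" and g0: "fps_nth g 0 = 1"
  shows "fps_nth h n = (-1) ^ n * det (mat n n (\<lambda>(i, j). if j \<le> i + 1 then fps_nth g (i + 1 - j) else 0))"
proof -
  define L where "L = lower_toeplitz_mat g (Suc n)"
  define B where "B = replace_col L (unit_vec (Suc n) 0) n"
  have L: "L \<in> carrier_mat (Suc n) (Suc n)" by (simp add: L_def)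
  have B: "B \<in> carrier_mat (Suc n) (Suc n)"
    using L by (simp add: B_def replace_col_def)
  have "L *\<^sub>v vec (Suc n) (fps_nth h) = unit_vec (Suc n) 0"
    unfolding L_def lower_toeplitz_mat_mult_vec inv by (auto simp: unit_vec_def)
  then have "det B = vec (Suc n) (fps_nth h) $ n * det L"
    unfolding B_def using cramer_lemma_mat[OF L, of "vec (Suc n) (fps_nth h)" n] by simp
  then have "fps_nth h n = det B"
    by (simp add: L_def det_lower_toeplitz_mat g0)
  also have "\<dots> = (\<Sum>i<Suc n. B $$ (i, n) * cofactor B i n)"
    using B by (rule laplace_expansion_column) simp
  also have "\<dots> = (\<Sum>i<Suc n. if i = 0 then cofactor B 0 n else 0)"
    using L by (intro sum.cong) (auto simp: B_def replace_col_def unit_vec_def)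
  also have "\<dots> = cofactor B 0 n"
    by simp
  also have "\<dots> = (-1) ^ n * det (mat_delete B 0 n)"
    by (simp add: cofactor_def)
  also have "mat_delete B 0 n = mat n n (\<lambda>(i, j). if j \<le> i + 1 then fps_nth g (i + 1 - j) else 0)"
    by (rule eq_matI)
      (auto simp: B_def L_def replace_col_def mat_delete_def lower_toeplitz_mat_def)
  finally show ?thesis .
qed

text \<open>
  Multiplying out \<open>f ^ r\<close> gives one summand for each way to choose the exponents
  \<open>i\<^sub>1, \<dots>, i\<^sub>r\<close> of total degree \<open>e\<close>, which is the sum that defines \<open>D d r e\<close>.
\<close>

lemma D_eq_fps_nth_power:
  assumes "r \<ge> 1"
  shows "D d r e = fps_nth (exp_gen_fun d ^ r) e"
proof -
  obtain k where k: "r = Suc k"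
    using assms by (cases r) auto
  show ?thesis
    unfolding k D_def fps_power_nth_Suc natpermute_def exp_gen_fun_def
    by (intro sum.cong) (auto simp: prod_dividef lessThan_Suc_atMost atMost_atLeast0)
qed

theorem theorem2:
  fixes r n :: nat
    and f :: "complex fps"
    and d a :: "nat \<Rightarrow> complex"
  assumes "r \<ge> 1"
    and "f = exp_gen_fun d"
    and "d 0 = 1"
    and "1 / f ^ r = exp_gen_fun a"
    and "n \<ge> 1"
  shows "a n = (-1) ^ n * fact n * det (D_matrix d r n)"
proof -
  have g0: "fps_nth (f ^ r) 0 = 1"
    using assms(2,3) by (simp add: exp_gen_fun_def fps_nth_power_0)
  then have "exp_gen_fun a * f ^ r = 1"
    unfolding assms(4)[symmetric] by (simp add: fps_divide_unit inverse_mult_eq_1)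
  note fps_nth_inverse_eq_det[OF this g0, of n]
  moreover have "mat n n (\<lambda>(i, j). if j \<le> i + 1 then fps_nth (f ^ r) (i + 1 - j) else 0) = D_matrix d r n"
    using g0 assms(1,2)
    by (intro eq_matI) (auto simp: D_matrix_def D_eq_fps_nth_power le_Suc_eq Suc_diff_le)
  ultimately show ?thesis
    by (simp add: exp_gen_fun_def field_simps)
qed

end
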